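(* Let $\mathbb K$ be $\mathbb H$ or $\mathbb O$ and $m=\dim\mathbb K\in\{4,8\}$. Let $N=(0,\dots,0,1)$ and $S=(0,\dots,0,-1)$ be the poles of the unit sphere $S^m\subset\mathbb R^{m+1}\cong\mathbb K\times\mathbb R$, and let $$f:\mathbb K\to S^m\setminus\{N\},\qquad f(x+Iy)=\left(\frac{2(x+Iy)}{1+x^2+y^2},\ \frac{-1+x^2+y^2}{1+x^2+y^2}\right),$$ $$h:\mathbb K\to S^m\setminus\{S\},\qquad h(x+Iy)=\left(\frac{2(x-Iy)}{1+x^2+y^2},\ \frac{1-x^2-y^2}{1+x^2+y^2}\right)$$ for $x,y\in\mathbb R$, $I\in\mathbb S$. Then the differentiable conformal atlas $\{(\mathbb K,f),(\mathbb K,h)\}$ endows $S^m\subset\mathbb R^{m+1}$ with a structure of slice quaternionic manifold (if $\mathbb K=\mathbb H$) or slice octonionic manifold (if $\mathbb K=\mathbb O$).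
   Context: $\mathbb K$ is the division algebra of quaternions $\mathbb H$ or octonions $\mathbb O$, identified with $\mathbb R^{\dim\mathbb K}$ with the Euclidean scalar product. $\mathbb S=\{I\in\mathbb K: I^2=-1\}$; every $q\in\mathbb K$ can be written $q=x+Iy$ with $x,y\in\mathbb R$, $I\in\mathbb S$; $\mathbb C_I=\mathbb R+I\mathbb R$. A slice domain $\Omega\subseteq\mathbb K$ is an open connected set containing real points such that $\Omega_I=\Omega\cap\mathbb C_I$ is a domain of $\mathbb C_I$ for each $I\in\mathbb S$. A function $g:\Omega\to\mathbb K$ is slice regular if for every $I\in\mathbb S$ the restriction $g_I=g_{|\Omega_I}$ has continuous partial derivatives and $\frac12\left(\frac{\partial}{\partial x}+I\frac{\partial}{\partial y}\right)g_I(x+yI)\equiv0$ on $\Omega_I$. The atlas is given by the local parameterizations $f,h$ (conformal diffeomorphisms onto open subsets of $S^m$). A (one-dimensional) slice quaternionic, respectively slice octonionic, manifold is a differentiable manifold with an atlas of such $\mathbb K$-valued coordinates ($\mathbb K=\mathbb H$, respectively $\mathbb O$) whose transition maps (here $h^{-1}\circ f$ and $f^{-1}\circ h$ on $\mathbb K\setminus\{0\}$) are slice regular functions. *)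

theory Defs
  imports "HOL-Analysis.Analysis"
begin

section \<open>Quaternions\<close>

datatype quat = Quat (qre: real) (qi: real) (qj: real) (qk: real)

lemma quat_eq_iff: "p = q \<longleftrightarrow> qre p = qre q \<and> qi p = qi q \<and> qj p = qj q \<and> qk p = qk q"
  by (cases p; cases q) simp

instantiation quat :: real_vector
begin
definition "0 = Quat 0 0 0 0"
definition "p + q = Quat (qre p + qre q) (qi p + qi q) (qj p + qj q) (qk p + qk q)"
definition "p - q = Quat (qre p - qre q) (qi p - qi q) (qj p - qj q) (qk p - qk q)" for p q :: quat
definition "- q = Quat (- qre q) (- qi q) (- qj q) (- qk q)"
definition "r *\<^sub>R q = Quat (r * qre q) (r * qi q) (r * qj q) (r * qk q)"
instance
  by standard
    (auto simp: quat_eq_iff zero_quat_def plus_quat_def minus_quat_def uminus_quat_def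
      scaleR_quat_def algebra_simps)
end

instantiation quat :: real_inner
begin
definition inner_quat_def: "inner p q = qre p * qre q + qi p * qi q + qj p * qj q + qk p * qk q"
definition norm_quat_def: "norm (q::quat) = sqrt (inner q q)"
definition sgn_quat_def: "sgn q = inverse (norm q) *\<^sub>R (q::quat)"
definition dist_quat_def: "dist p q = norm (p - q)" for p q :: quat
definition uniformity_quat_def [code del]:
  "(uniformity :: (quat \<times> quat) filter) = (INF e\<in>{0 <..}. principal {(x, y). dist x y < e})"
definition open_quat_def [code del]:
  "open (U :: quat set) \<longleftrightarrow> (\<forall>x\<in>U. eventually (\<lambda>(x', y). x' = x \<longrightarrow> y \<in> U) uniformity)"
instance
proof
  fix p q s :: quat and r :: real
  show "inner p q = inner q p"
    and "inner (p + q) s = inner p s + inner q s"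
    and "inner (r *\<^sub>R p) q = r * inner p q"
    by (simp_all add: inner_quat_def plus_quat_def scaleR_quat_def algebra_simps)
  show "0 \<le> inner p p"
    by (simp add: inner_quat_def)
  show "inner p p = 0 \<longleftrightarrow> p = 0"
    by (auto simp: inner_quat_def quat_eq_iff zero_quat_def add_nonneg_eq_0_iff)
qed (rule sgn_quat_def dist_quat_def uniformity_quat_def open_quat_def norm_quat_def)+
end

instantiation quat :: euclidean_space
begin
definition Basis_quat_def:
  "Basis = {Quat 1 0 0 0, Quat 0 1 0 0, Quat 0 0 1 0, Quat 0 0 0 1}"
instance
proof
  fix u v x :: quat
  show "u \<in> Basis \<Longrightarrow> v \<in> Basis \<Longrightarrow> inner u v = (if u = v then 1 else 0)"
    unfolding Basis_quat_def inner_quat_def by (elim insertE emptyE) simp_all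
  show "(\<forall>u\<in>Basis. inner x u = 0) \<longleftrightarrow> x = 0"
    by (simp add: Basis_quat_def inner_quat_def quat_eq_iff[of x] zero_quat_def)
qed (simp_all add: Basis_quat_def)
end

lemma DIM_quat: "DIM(quat) = 4"
  by (simp add: Basis_quat_def)

instantiation quat :: "{one, times}"
begin
definition "1 = Quat 1 0 0 0"
definition times_quat_def:
  "p * q = Quat
    (qre p * qre q - qi p * qi q - qj p * qj q - qk p * qk q)
    (qre p * qi q + qi p * qre q + qj p * qk q - qk p * qj q)
    (qre p * qj q - qi p * qk q + qj p * qre q + qk p * qi q)
    (qre p * qk q + qi p * qj q - qj p * qi q + qk p * qre q)"
instance ..
end

definition qcnj :: "quat \<Rightarrow> quat" where
  "qcnj q = Quat (qre q) (- qi q) (- qj q) (- qk q)"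


section \<open>Octonions\<close>

text \<open>Pairs of quaternions, multiplied by the Cayley--Dickson rule.\<close>

datatype oct = Oct (ofst: quat) (osnd: quat)

lemma oct_eq_iff: "p = q \<longleftrightarrow> ofst p = ofst q \<and> osnd p = osnd q"
  by (cases p; cases q) simp

instantiation oct :: real_vector
begin
definition "0 = Oct 0 0"
definition "p + q = Oct (ofst p + ofst q) (osnd p + osnd q)"
definition "p - q = Oct (ofst p - ofst q) (osnd p - osnd q)" for p q :: oct
definition "- q = Oct (- ofst q) (- osnd q)"
definition "r *\<^sub>R q = Oct (r *\<^sub>R ofst q) (r *\<^sub>R osnd q)"
instance
  by standard
    (auto simp: oct_eq_iff zero_oct_def plus_oct_def minus_oct_def uminus_oct_def
      scaleR_oct_def algebra_simps)
end

instantiation oct :: real_inner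
begin
definition inner_oct_def: "inner p q = inner (ofst p) (ofst q) + inner (osnd p) (osnd q)"
definition norm_oct_def: "norm (q::oct) = sqrt (inner q q)"
definition sgn_oct_def: "sgn q = inverse (norm q) *\<^sub>R (q::oct)"
definition dist_oct_def: "dist p q = norm (p - q)" for p q :: oct
definition uniformity_oct_def [code del]:
  "(uniformity :: (oct \<times> oct) filter) = (INF e\<in>{0 <..}. principal {(x, y). dist x y < e})"
definition open_oct_def [code del]:
  "open (U :: oct set) \<longleftrightarrow> (\<forall>x\<in>U. eventually (\<lambda>(x', y). x' = x \<longrightarrow> y \<in> U) uniformity)"
instance
proof
  fix p q s :: oct and r :: real
  show "inner p q = inner q p"
    by (simp add: inner_oct_def inner_commute)
  show "inner (p + q) s = inner p s + inner q s"
    and "inner (r *\<^sub>R p) q = r * inner p q"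
    by (simp_all add: inner_oct_def plus_oct_def scaleR_oct_def algebra_simps)
  show "0 \<le> inner p p"
    by (simp add: inner_oct_def)
  show "inner p p = 0 \<longleftrightarrow> p = 0"
    by (auto simp: inner_oct_def oct_eq_iff zero_oct_def add_nonneg_eq_0_iff)
qed (rule sgn_oct_def dist_oct_def uniformity_oct_def open_oct_def norm_oct_def)+
end

instantiation oct :: euclidean_space
begin
definition Basis_oct_def:
  "Basis = (\<lambda>b. Oct b 0) ` Basis \<union> (\<lambda>b. Oct 0 b) ` Basis"
instance
proof
  fix u v x :: oct
  show "u \<in> Basis \<Longrightarrow> v \<in> Basis \<Longrightarrow> inner u v = (if u = v then 1 else 0)"
    by (auto simp: Basis_oct_def inner_oct_def inner_Basis split: if_splits)
  show "(\<forall>u\<in>Basis. inner x u = 0) \<longleftrightarrow> x = 0"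
    by (auto simp: Basis_oct_def inner_oct_def ball_Un oct_eq_iff zero_oct_def
        euclidean_all_zero_iff)
qed (auto simp: Basis_oct_def)
end

lemma DIM_oct: "DIM(oct) = 8"
proof -
  have "(\<lambda>b. Oct b 0) ` Basis \<inter> (\<lambda>b. Oct 0 b) ` Basis = {}"
    by auto
  then show ?thesis
    by (simp add: Basis_oct_def card_Un_disjoint card_image inj_on_def DIM_quat)
qed

instantiation oct :: "{one, times}"
begin
definition "1 = Oct 1 0"
definition times_oct_def:
  "p * q = Oct
    (ofst p * ofst q - qcnj (osnd q) * osnd p)
    (osnd q * ofst p + osnd p * qcnj (ofst q))"
instance ..
end


section \<open>Slice regular functions\<close>

text \<open>The notions below are stated for any Euclidean space with a unit and a multiplication, so
  that they apply to both \<^typ>\<open>quat\<close> and the non-associative \<^typ>\<open>oct\<close>. A real number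
  \<open>x\<close> is embedded as \<open>x *\<^sub>R 1\<close>.\<close>

definition imag_units :: "'k::{euclidean_space, one, times} set" where
  "imag_units = {I. I * I = - 1}"

definition slice_point :: "'k::{euclidean_space, one, times} \<Rightarrow> real \<Rightarrow> real \<Rightarrow> 'k" where
  "slice_point I x y = x *\<^sub>R 1 + y *\<^sub>R I"

definition slice_plane :: "'k::{euclidean_space, one, times} \<Rightarrow> 'k set" where
  "slice_plane I = {slice_point I x y | x y. True}"

definition slice_domain :: "'k::{euclidean_space, one, times} set \<Rightarrow> bool" where
  "slice_domain \<Omega> \<longleftrightarrow>
    open \<Omega> \<and> connected \<Omega> \<and> (\<exists>x::real. x *\<^sub>R 1 \<in> \<Omega>) \<and>
    (\<forall>I\<in>imag_units.
      openin (top_of_set (slice_plane I)) (\<Omega> \<inter> slice_plane I) \<and>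
      connected (\<Omega> \<inter> slice_plane I) \<and> \<Omega> \<inter> slice_plane I \<noteq> {})"

text \<open>\<open>gx\<close> and \<open>gy\<close> are the partial derivatives of \<open>(x, y) \<mapsto> g (x + yI)\<close>; the unit \<open>I\<close> multiplies
  from the left.\<close>

definition slice_regular_on ::
    "'k::{euclidean_space, one, times} set \<Rightarrow> ('k \<Rightarrow> 'k) \<Rightarrow> bool" where
  "slice_regular_on \<Omega> g \<longleftrightarrow> slice_domain \<Omega> \<and>
    (\<forall>I\<in>imag_units. \<exists>gx gy :: real \<times> real \<Rightarrow> 'k.
      continuous_on {(x, y). slice_point I x y \<in> \<Omega>} gx \<and>
      continuous_on {(x, y). slice_point I x y \<in> \<Omega>} gy \<and>
      (\<forall>x y. slice_point I x y \<in> \<Omega> \<longrightarrow>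
        ((\<lambda>s. g (slice_point I s y)) has_vector_derivative gx (x, y)) (at x) \<and>
        ((\<lambda>t. g (slice_point I x t)) has_vector_derivative gy (x, y)) (at y) \<and>
        (1 / 2) *\<^sub>R (gx (x, y) + I * gy (x, y)) = 0))"


section \<open>Smooth maps and conformal diffeomorphisms\<close>

primrec Ck_on ::
    "nat \<Rightarrow> 'a::real_normed_vector set \<Rightarrow> ('a \<Rightarrow> 'b::real_normed_vector) \<Rightarrow> bool" where
  "Ck_on 0 W f \<longleftrightarrow> continuous_on W f"
| "Ck_on (Suc k) W f \<longleftrightarrow>
    (\<forall>x\<in>W. f differentiable (at x)) \<and>
    (\<forall>v. Ck_on k W (\<lambda>x. frechet_derivative f (at x) v))"

text \<open>Smoothness on an arbitrary subset of a Euclidean space (in particular on an embedded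
  submanifold such as a sphere) means local extendability to a \<open>C\<^sup>\<infinity>\<close> map of the ambient space.\<close>

definition smooth_on ::
    "'a::euclidean_space set \<Rightarrow> ('a \<Rightarrow> 'b::euclidean_space) \<Rightarrow> bool" where
  "smooth_on T f \<longleftrightarrow>
    (\<forall>p\<in>T. \<exists>W F. open W \<and> p \<in> W \<and> (\<forall>k. Ck_on k W F) \<and> (\<forall>x\<in>W \<inter> T. F x = f x))"

text \<open>\<open>T\<close> carries the differentiable and Riemannian structure induced by the ambient space.\<close>

definition conformal_diffeomorphism ::
    "'a::euclidean_space set \<Rightarrow> 'b::euclidean_space set \<Rightarrow> ('a \<Rightarrow> 'b) \<Rightarrow> bool" where
  "conformal_diffeomorphism U T f \<longleftrightarrow>
    open U \<and> bij_betw f U T \<and> smooth_on U f \<and> smooth_on T (inv_into U f) \<and>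
    (\<forall>q\<in>U. \<exists>c>0. \<forall>v w.
      inner (frechet_derivative f (at q) v) (frechet_derivative f (at q) w) = c * inner v w)"


section \<open>Slice manifolds\<close>

text \<open>An atlas is a set of local parametrizations \<open>(U, \<phi>)\<close>, where \<open>\<phi>\<close> maps the open set
  \<open>U\<close> of the model space homeomorphically onto an open subset of the manifold.\<close>

type_synonym ('k, 'm) atlas = "('k set \<times> ('k \<Rightarrow> 'm)) set"

definition trans_dom :: "'k set \<times> ('k \<Rightarrow> 'm) \<Rightarrow> 'k set \<times> ('k \<Rightarrow> 'm) \<Rightarrow> 'k set" where
  "trans_dom a b = {q \<in> fst a. snd a q \<in> snd b ` fst b}"

definition trans_map :: "'k set \<times> ('k \<Rightarrow> 'm) \<Rightarrow> 'k set \<times> ('k \<Rightarrow> 'm) \<Rightarrow> 'k \<Rightarrow> 'k" where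
  "trans_map a b = inv_into (fst b) (snd b) \<circ> snd a"

definition differentiable_manifold ::
    "'m topology \<Rightarrow> ('k::euclidean_space, 'm) atlas \<Rightarrow> bool" where
  "differentiable_manifold X A \<longleftrightarrow>
    Hausdorff_space X \<and> second_countable X \<and>
    (\<forall>(U, \<phi>)\<in>A. open U \<and> openin X (\<phi> ` U) \<and>
      homeomorphic_map (top_of_set U) (subtopology X (\<phi> ` U)) \<phi>) \<and>
    (\<Union>(U, \<phi>)\<in>A. \<phi> ` U) = topspace X \<and>
    (\<forall>a\<in>A. \<forall>b\<in>A. smooth_on (trans_dom a b) (trans_map a b))"

text \<open>Since \<^const>\<open>slice_regular_on\<close> includes \<^const>\<open>slice_domain\<close>, which excludes the empty
  set, pairs of charts that do not overlap are exempted.\<close>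

definition slice_manifold ::
    "'m topology \<Rightarrow> ('k::{euclidean_space, one, times}, 'm) atlas \<Rightarrow> bool" where
  "slice_manifold X A \<longleftrightarrow> differentiable_manifold X A \<and>
    (\<forall>a\<in>A. \<forall>b\<in>A. trans_dom a b \<noteq> {} \<longrightarrow> slice_regular_on (trans_dom a b) (trans_map a b))"

abbreviation slice_quaternionic_manifold :: "'m topology \<Rightarrow> (quat, 'm) atlas \<Rightarrow> bool" where
  "slice_quaternionic_manifold \<equiv> slice_manifold"

abbreviation slice_octonionic_manifold :: "'m topology \<Rightarrow> (oct, 'm) atlas \<Rightarrow> bool" where
  "slice_octonionic_manifold \<equiv> slice_manifold"


section \<open>The two parametrizations of the sphere\<close>

text \<open>Each predicate determines its map uniquely: every \<open>q\<close> has the form \<open>x + yI\<close>, and \<open>x - yI\<close> and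
  \<open>x\<^sup>2 + y\<^sup>2\<close> depend only on \<open>q\<close>. The poles are \<open>N = (0, 1)\<close> and \<open>S = (0, -1)\<close>.\<close>

definition is_sphere_param_f ::
    "('k::{euclidean_space, one, times} \<Rightarrow> 'k \<times> real) \<Rightarrow> bool" where
  "is_sphere_param_f f \<longleftrightarrow> (\<forall>x y. \<forall>I\<in>imag_units.
    f (slice_point I x y) =
      ((2 / (1 + x\<^sup>2 + y\<^sup>2)) *\<^sub>R slice_point I x y, (- 1 + x\<^sup>2 + y\<^sup>2) / (1 + x\<^sup>2 + y\<^sup>2)))"

definition is_sphere_param_h ::
    "('k::{euclidean_space, one, times} \<Rightarrow> 'k \<times> real) \<Rightarrow> bool" where
  "is_sphere_param_h h \<longleftrightarrow> (\<forall>x y. \<forall>I\<in>imag_units.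
    h (slice_point I x y) =
      ((2 / (1 + x\<^sup>2 + y\<^sup>2)) *\<^sub>R slice_point I x (- y), (1 - x\<^sup>2 - y\<^sup>2) / (1 + x\<^sup>2 + y\<^sup>2)))"

end

theory Submission
  imports Defs
begin

text \<open>Both charts have the form \<open>q \<mapsto> (2 E q / (1 + |q|\<^sup>2), e (|q|\<^sup>2 - 1) / (1 + |q|\<^sup>2))\<close>
  with a linear isometric involution \<open>E\<close> and a sign \<open>e\<close>: \<open>f\<close> is the case \<open>E = id\<close>, \<open>e = 1\<close>, and
  \<open>h\<close> is the case where \<open>E\<close> is conjugation and \<open>e = -1\<close>. Inverting the stereographic projection
  shows that both transition maps are the inversion \<open>q \<mapsto> q\<^sup>* / |q|\<^sup>2\<close> of \<open>K - {0}\<close>; on each plane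
  \<open>\<complex>\<^sub>I\<close> this is the holomorphic function \<open>z \<mapsto> 1 / z\<close>.\<close>

section \<open>Maps of class \<open>C\<^sup>k\<close>\<close>

text \<open>A Frechet derivative at a point of an open set depends only on values near that point,
  so agreement on \<open>W\<close> passes to the derivatives of every order.\<close>

lemma Ck_on_cong:
  assumes "open W" "\<And>x. x \<in> W \<Longrightarrow> f x = g x" "Ck_on k W f"
  shows "Ck_on k W g"
  using assms(2,3)
proof (induction k arbitrary: f g)
  case 0
  have "continuous_on W g \<longleftrightarrow> continuous_on W f"
    by (rule continuous_on_cong) (simp_all add: 0(1))
  with 0(2) show ?case by simp
next
  case (Suc k)
  have D: "(g has_derivative frechet_derivative f (at x)) (at x)" if "x \<in> W" for x
  proof (rule has_derivative_transform_within_open[OF _ \<open>open W\<close> that])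
    show "(f has_derivative frechet_derivative f (at x)) (at x)"
      using Suc.prems(2) that by (simp add: frechet_derivative_works)
  qed (rule Suc.prems(1))
  have eq: "frechet_derivative g (at x) = frechet_derivative f (at x)" if "x \<in> W" for x
    using frechet_derivative_at[OF D[OF that]] by (rule sym)
  have "Ck_on k W (\<lambda>x. frechet_derivative g (at x) v)" for v
  proof (rule Suc.IH)
    show "Ck_on k W (\<lambda>x. frechet_derivative f (at x) v)"
      using Suc.prems(2) by simp
  qed (simp add: eq)
  moreover have "g differentiable (at x)" if "x \<in> W" for x
    using D[OF that] by (rule differentiableI)
  ultimately show ?case by simp
qed

text \<open>By uniqueness of Frechet derivatives, any explicit derivative \<open>f'\<close> can
  replace \<open>frechet_derivative\<close>. The closure rules below use this to run their
  inductions on the usual differentiation formulas.\<close>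

lemma Ck_on_SucI:
  assumes "open W" "\<And>x. x \<in> W \<Longrightarrow> (f has_derivative f' x) (at x)"
    and "\<And>v. Ck_on k W (\<lambda>x. f' x v)"
  shows "Ck_on (Suc k) W f"
proof -
  have "frechet_derivative f (at x) = f' x" if "x \<in> W" for x
    using frechet_derivative_at[OF assms(2)[OF that]] by (rule sym)
  then have "Ck_on k W (\<lambda>x. frechet_derivative f (at x) v)" for v
    by (intro Ck_on_cong[OF \<open>open W\<close> _ assms(3)]) simp
  then show ?thesis
    using differentiableI[OF assms(2)] by simp
qed

lemma Ck_on_Suc_has_derivative:
  "Ck_on (Suc k) W f \<Longrightarrow> x \<in> W \<Longrightarrow> (f has_derivative frechet_derivative f (at x)) (at x)"
  by (simp add: frechet_derivative_works)

text \<open>Differentiability gives continuity at order 0; higher orders follow by applying the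
  induction hypothesis to each directional derivative. The Leibniz rule needs this, since it keeps
  undifferentiated factors.\<close>

lemma Ck_on_SucD: "Ck_on (Suc k) W f \<Longrightarrow> Ck_on k W f"
proof (induction k arbitrary: f)
  case 0
  then show ?case
    by (auto intro!: continuous_at_imp_continuous_on differentiable_imp_continuous_within)
qed simp

lemma Ck_on_const: "Ck_on k W (\<lambda>x. c)"
  by (induction k arbitrary: c) (auto simp: frechet_derivative_const)

lemma Ck_on_ident: "open W \<Longrightarrow> Ck_on k W (\<lambda>x. x)"
proof (cases k)
  case (Suc m)
  then show "open W \<Longrightarrow> ?thesis"
    using Ck_on_SucI[of W "\<lambda>x. x" "\<lambda>x v. v" m] by (simp only: has_derivative_ident Ck_on_const)
qed simp

lemma Ck_on_linear:
  assumes "bounded_linear L" "open W" "Ck_on k W f"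
  shows "Ck_on k W (\<lambda>x. L (f x))"
  using assms(3)
proof (induction k arbitrary: f)
  case 0
  then show ?case by (simp add: bounded_linear.continuous_on[OF assms(1)])
next
  case (Suc k)
  show ?case
  proof (rule Ck_on_SucI[OF \<open>open W\<close>])
    show "((\<lambda>x. L (f x)) has_derivative (\<lambda>v. L (frechet_derivative f (at x) v))) (at x)"
      if "x \<in> W" for x
      by (rule bounded_linear.has_derivative[OF assms(1) Ck_on_Suc_has_derivative[OF Suc.prems that]])
    show "Ck_on k W (\<lambda>x. L (frechet_derivative f (at x) v))" for v
      using Suc.prems by (intro Suc.IH) simp
  qed
qed

lemma Ck_on_add:
  assumes "open W" "Ck_on k W f" "Ck_on k W g"
  shows "Ck_on k W (\<lambda>x. f x + g x)"
  using assms(2,3)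
proof (induction k arbitrary: f g)
  case 0
  then show ?case by (simp add: continuous_on_add)
next
  case (Suc k)
  show ?case
  proof (rule Ck_on_SucI[OF \<open>open W\<close>])
    show "((\<lambda>x. f x + g x) has_derivative
        (\<lambda>v. frechet_derivative f (at x) v + frechet_derivative g (at x) v)) (at x)"
      if "x \<in> W" for x
      using Suc.prems that by (intro has_derivative_add Ck_on_Suc_has_derivative)
    show "Ck_on k W (\<lambda>x. frechet_derivative f (at x) v + frechet_derivative g (at x) v)" for v
      using Suc.prems by (intro Suc.IH) simp_all
  qed
qed

text \<open>Each term of the Leibniz rule pairs a factor with a derivative of the other; both have
  class \<open>k\<close>, so the induction hypothesis applies to each term.\<close>

lemma Ck_on_bilinear:
  assumes "bounded_bilinear B" "open W" "Ck_on k W f" "Ck_on k W g"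
  shows "Ck_on k W (\<lambda>x. B (f x) (g x))"
  using assms(3,4)
proof (induction k arbitrary: f g)
  case 0
  then show ?case by (simp add: bounded_bilinear.continuous_on[OF assms(1)])
next
  case (Suc k)
  show ?case
  proof (rule Ck_on_SucI[OF \<open>open W\<close>])
    show "((\<lambda>x. B (f x) (g x)) has_derivative
        (\<lambda>v. B (f x) (frechet_derivative g (at x) v) + B (frechet_derivative f (at x) v) (g x))) (at x)"
      if "x \<in> W" for x
      using Suc.prems that
      by (intro bounded_bilinear.FDERIV[OF assms(1)] Ck_on_Suc_has_derivative)
    show "Ck_on k W
        (\<lambda>x. B (f x) (frechet_derivative g (at x) v) + B (frechet_derivative f (at x) v) (g x))" for v
      using Suc.prems Suc.prems[THEN Ck_on_SucD]
      by (intro Ck_on_add \<open>open W\<close> Suc.IH) simp_all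
  qed
qed

text \<open>The derivative of \<open>1 / f\<close> is a product of \<open>1 / f\<close>,
  \<open>Df\<close> and \<open>1 / f\<close>, up to sign. The induction hypothesis covers
  \<open>1 / f\<close> and the product rule does the rest.\<close>

lemma Ck_on_inverse:
  fixes f :: "'a::real_normed_vector \<Rightarrow> real"
  assumes "open W" "\<And>x. x \<in> W \<Longrightarrow> f x \<noteq> 0" "Ck_on k W f"
  shows "Ck_on k W (\<lambda>x. inverse (f x))"
  using assms(3)
proof (induction k)
  case 0
  then show ?case using assms(2) by (auto intro!: continuous_on_inverse)
next
  case (Suc k)
  note mult = Ck_on_bilinear[OF bounded_bilinear_mult \<open>open W\<close>]
  have IH: "Ck_on k W (\<lambda>x. inverse (f x))"
    using Suc.IH Suc.prems Ck_on_SucD by blast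
  show ?case
  proof (rule Ck_on_SucI[OF \<open>open W\<close>])
    show "((\<lambda>x. inverse (f x)) has_derivative
        (\<lambda>v. - (inverse (f x) * frechet_derivative f (at x) v * inverse (f x)))) (at x)"
      if "x \<in> W" for x
      by (rule Deriv.has_derivative_inverse[OF assms(2)[OF that]
            Ck_on_Suc_has_derivative[OF Suc.prems that]])
    show "Ck_on k W (\<lambda>x. - (inverse (f x) * frechet_derivative f (at x) v * inverse (f x)))" for v
    proof -
      have "Ck_on k W (\<lambda>x. frechet_derivative f (at x) v)"
        using Suc.prems by simp
      from mult[OF mult[OF IH this] IH] show ?thesis
        by (rule Ck_on_linear[OF bounded_linear_minus[OF bounded_linear_ident] \<open>open W\<close>])
    qed
  qed
qed

text \<open>Splitting \<open>(f, g) = (f, 0) + (0, g)\<close> reduces pairing to linear maps and a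
  sum.\<close>

lemma Ck_on_Pair:
  assumes "open W" "Ck_on k W f" "Ck_on k W g"
  shows "Ck_on k W (\<lambda>x. (f x, g x))"
proof -
  have "Ck_on k W (\<lambda>x. (f x, 0))"
    by (rule Ck_on_linear[OF _ assms(1,2)])
      (rule bounded_linear_Pair[OF bounded_linear_ident bounded_linear_zero])
  moreover have "Ck_on k W (\<lambda>x. (0, g x))"
    by (rule Ck_on_linear[OF _ assms(1,3)])
      (rule bounded_linear_Pair[OF bounded_linear_zero bounded_linear_ident])
  ultimately have "Ck_on k W (\<lambda>x. (f x, 0) + (0, g x))"
    by (rule Ck_on_add[OF assms(1)])
  then show ?thesis by simp
qed

lemma smooth_onI:
  assumes "open W" "T \<subseteq> W" "\<And>k. Ck_on k W F" "\<And>x. x \<in> T \<Longrightarrow> F x = f x"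
  shows "smooth_on T f"
  unfolding smooth_on_def using assms by blast


section \<open>Stereographic projection\<close>

lemma sphere_Pair_iff:
  fixes p :: "'a::real_inner"
  shows "(p, t::real) \<in> sphere 0 1 \<longleftrightarrow> inner p p + t * t = 1"
proof -
  have "(p, t) \<in> sphere 0 1 \<longleftrightarrow> inner (p, t) (p, t) = 1"
    by (simp only: mem_sphere_0 norm_eq_1)
  then show ?thesis by simp
qed

lemma one_plus_inner_pos: "0 < 1 + inner q (q::'a::real_inner)"
  using inner_ge_zero[of q] by linarith

locale stereographic =
  fixes E :: "'a::euclidean_space \<Rightarrow> 'a" and e :: real
  assumes linear_E: "linear E" and E_E: "\<And>q. E (E q) = q"
    and inner_E: "\<And>p q. inner (E p) (E q) = inner p q" and e_e: "e * e = 1"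
begin

definition param :: "'a \<Rightarrow> 'a \<times> real" where
  "param q = ((2 / (1 + inner q q)) *\<^sub>R E q, e * ((inner q q - 1) / (1 + inner q q)))"

text \<open>Central projection from the pole \<open>(0, e)\<close> onto the equatorial hyperplane,
  followed by \<open>E\<close>. Its denominator vanishes at the pole.\<close>

definition proj :: "'a \<times> real \<Rightarrow> 'a" where
  "proj z = (1 / (1 - e * snd z)) *\<^sub>R E (fst z)"

lemma bounded_linear_E: "bounded_linear E"
  using linear_E by (simp add: linear_linear)

lemma E_scaleR: "E (r *\<^sub>R q) = r *\<^sub>R E q"
  by (simp add: linear_E linear_cmul)

section \<open>The chart and the projection are mutually inverse\<close>

lemma proj_param: "proj (param q) = q"
proof -
  have t: "1 - e * (e * ((inner q q - 1) / (1 + inner q q))) = 2 / (1 + inner q q)"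
    using one_plus_inner_pos[of q] e_e by (simp add: mult.assoc[symmetric] field_simps)
  have r: "1 / (2 / (1 + inner q q)) * (2 / (1 + inner q q)) = 1"
    using one_plus_inner_pos[of q] by simp
  show ?thesis
    unfolding proj_def param_def fst_conv snd_conv E_scaleR E_E scaleR_scaleR t r
    by (rule scaleR_one)
qed

text \<open>A zero denominator forces the last coordinate to be \<open>e\<close>; the equation of
  the sphere then forces the first component to be 0, which is the excluded pole.\<close>

lemma denominator_nonzero:
  fixes z :: "'a \<times> real"
  assumes "z \<in> sphere 0 1 - {(0, e)}"
  shows "1 - e * snd z \<noteq> 0"
proof
  obtain p t where z: "z = (p, t)" by fastforce
  assume "1 - e * snd z = 0"
  then have "e * t = 1" by (simp add: z)
  then have "t = e" using e_e by (metis mult_cancel_left mult_zero_left zero_neq_one)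
  moreover have "inner p p + t * t = 1" "(p, t) \<noteq> (0, e)"
    using assms by (simp_all only: z Diff_iff sphere_Pair_iff) auto
  ultimately show False using e_e by simp
qed

text \<open>With \<open>a = 1 - e * t\<close> the equation of the sphere reads
  \<open>inner p p = a * (2 - a)\<close>. Hence the projected point has squared norm
  \<open>2 / a - 1\<close>, and \<open>param\<close> returns \<open>p\<close> and
  \<open>e * (1 - a) = t\<close>.\<close>

lemma param_proj:
  assumes "z \<in> sphere 0 1 - {(0, e)}"
  shows "param (proj z) = z"
proof -
  obtain p t where z: "z = (p, t)" by fastforce
  define a where "a = 1 - e * t"
  have a: "a \<noteq> 0" using denominator_nonzero[OF assms] by (simp add: z a_def)
  have "(e * t) * (e * t) = t * t" using e_e by (metis mult.assoc mult.commute mult_1)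
  moreover have "inner p p + t * t = 1"
    using assms by (simp only: z Diff_iff sphere_Pair_iff)
  ultimately have "inner p p = 1 - (e * t) * (e * t)" by linarith
  also have "\<dots> = a * (2 - a)" by (simp add: a_def algebra_simps)
  finally have s: "inner (proj z) (proj z) = 2 / a - 1"
    using a by (simp add: proj_def z inner_E diff_divide_distrib flip: a_def)
  have "2 / (1 + inner (proj z) (proj z)) = a"
    and "(inner (proj z) (proj z) - 1) / (1 + inner (proj z) (proj z)) = 1 - a"
    unfolding s using a by (simp_all add: field_simps)
  then have "param (proj z) = (a *\<^sub>R E (proj z), e * (1 - a))"
    by (simp only: param_def)
  also have "\<dots> = z"
    using a e_e by (simp add: z proj_def E_scaleR E_E flip: a_def)
      (simp add: a_def mult.assoc[symmetric])
  finally show ?thesis .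
qed

text \<open>With \<open>s\<close> the squared norm of \<open>q\<close>, membership in the sphere is
  the identity \<open>4 * s + (s - 1)^2 = (1 + s)^2\<close>. The pole is missed because
  \<open>(s - 1) / (1 + s)\<close> is never 1.\<close>

lemma param_in_sphere: "param q \<in> sphere 0 1 - {(0, e)}"
proof -
  define s where "s = inner q q"
  have s: "1 + s \<noteq> 0" using one_plus_inner_pos[of q] by (simp add: s_def)
  have "e * ((s - 1) / (1 + s)) * (e * ((s - 1) / (1 + s))) = ((s - 1) / (1 + s)) * ((s - 1) / (1 + s))"
    using e_e by algebra
  moreover have "2 / (1 + s) * (2 / (1 + s) * s) + ((s - 1) / (1 + s)) * ((s - 1) / (1 + s)) = 1"
    using s by (simp add: divide_simps) algebra
  ultimately have "param q \<in> sphere 0 1"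
    by (simp only: param_def sphere_Pair_iff inner_E inner_scaleR_left inner_scaleR_right
        flip: s_def)
  moreover have "(s - 1) / (1 + s) \<noteq> 1"
    using s by (simp add: field_simps)
  then have "e * ((s - 1) / (1 + s)) \<noteq> e"
    using e_e by (metis mult_cancel_left1 mult_zero_left zero_neq_one)
  then have "param q \<noteq> (0, e)"
    by (simp only: param_def prod.inject simp_thms flip: s_def)
  ultimately show ?thesis by simp
qed

lemma bij_betw_param: "bij_betw param UNIV (sphere 0 1 - {(0, e)})"
proof (rule bij_betw_byWitness[where f' = proj])
  show "range param \<subseteq> sphere 0 1 - {(0, e)}"
    using param_in_sphere by (simp only: image_subset_iff simp_thms ball_simps)
qed (use proj_param param_proj in \<open>simp_all del: Diff_iff\<close>)

lemma range_param: "range param = sphere 0 1 - {(0, e)}"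
  using bij_betw_param by (simp add: bij_betw_def)

text \<open>Smoothness and transition maps are defined through the choice-based inverse; off the
  pole, injectivity turns it into an explicit formula.\<close>

lemma inv_param:
  assumes "z \<in> sphere 0 1 - {(0, e)}"
  shows "inv param z = proj z"
  using param_proj[OF assms] proj_param by (metis inv_f_f injI)

text \<open>The opposite pole is the point omitted by the other chart, so this determines where the
  two charts overlap.\<close>

lemma param_eq_opposite_pole_iff: "param q = (0, - e) \<longleftrightarrow> q = 0"
proof
  assume "param q = (0, - e)"
  then have "q = proj (0, - e)" using proj_param by metis
  then show "q = 0" using linear_E by (simp add: proj_def linear_0)
qed (simp add: param_def linear_E linear_0)

section \<open>Smoothness of the chart and of its inverse\<close>

lemma Ck_on_param: "Ck_on k UNIV param"
proof -
  have "Ck_on k UNIV (\<lambda>q::'a. inner q q)"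
    by (intro Ck_on_bilinear[OF bounded_bilinear_inner] Ck_on_ident open_UNIV)
  \<comment> \<open>Used with \<open>r = 1\<close> for the denominators and with
    \<open>r = - 1\<close> for the numerator of the last coordinate.\<close>
  then have s: "Ck_on k UNIV (\<lambda>q::'a. r + inner q q)" for r
    by (intro Ck_on_add Ck_on_const open_UNIV)
  have i: "Ck_on k UNIV (\<lambda>q::'a. inverse (1 + inner q q))"
    by (intro Ck_on_inverse s open_UNIV less_imp_neq[THEN not_sym] one_plus_inner_pos)
  have "Ck_on k UNIV (\<lambda>q. ((2 * inverse (1 + inner q q)) *\<^sub>R E q,
      e * ((- 1 + inner q q) * inverse (1 + inner q q))))"
    by (intro Ck_on_Pair Ck_on_bilinear[OF bounded_bilinear_scaleR]
        Ck_on_bilinear[OF bounded_bilinear_mult] Ck_on_linear[OF bounded_linear_E]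
        Ck_on_ident Ck_on_const open_UNIV s i)
  then show ?thesis
    by (rule Ck_on_cong[OF open_UNIV, rotated]) (simp add: param_def divide_inverse)
qed

text \<open>The domain is open in the ambient space and contains the punctured sphere, so
  \<open>proj\<close> is the smooth extension that smoothness of the inverse chart asks for.\<close>

lemma Ck_on_proj: "Ck_on k {z. 1 - e * snd z \<noteq> 0} proj" (is "Ck_on k ?W _")
proof -
  have W: "open ?W"
    by (intro open_Collect_neq continuous_intros)
  have "Ck_on k ?W (\<lambda>z::'a \<times> real. 1 + (- e) * snd z)"
    by (intro Ck_on_add Ck_on_const W Ck_on_bilinear[OF bounded_bilinear_mult]
        Ck_on_linear[OF bounded_linear_snd] Ck_on_ident)
  then have i: "Ck_on k ?W (\<lambda>z::'a \<times> real. inverse (1 + (- e) * snd z))"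
    by (intro Ck_on_inverse W) auto
  have "Ck_on k ?W (\<lambda>z. inverse (1 + (- e) * snd z) *\<^sub>R E (fst z))"
    by (intro Ck_on_bilinear[OF bounded_bilinear_scaleR] i W Ck_on_linear[OF bounded_linear_E]
        Ck_on_linear[OF bounded_linear_fst] Ck_on_ident)
  then show ?thesis
    by (rule Ck_on_cong[OF W, rotated]) (simp add: proj_def divide_inverse)
qed

lemma smooth_on_inv_param: "smooth_on (sphere 0 1 - {(0, e)}) (inv param)"
proof (rule smooth_onI)
  show "open {z::'a \<times> real. 1 - e * snd z \<noteq> 0}"
    by (intro open_Collect_neq continuous_intros)
  show "sphere 0 1 - {(0, e)} \<subseteq> {z::'a \<times> real. 1 - e * snd z \<noteq> 0}"
    using denominator_nonzero by blast
qed (use Ck_on_proj inv_param in \<open>simp_all del: Diff_iff\<close>)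

section \<open>Derivative and conformality of the chart\<close>

lemma has_derivative_param:
  fixes q :: 'a
  defines "r \<equiv> inverse (1 + inner q q)"
  shows "(param has_derivative (\<lambda>v.
      ((2 * r) *\<^sub>R E v - (4 * inner q v * r\<^sup>2) *\<^sub>R E q, e * (4 * inner q v * r\<^sup>2)))) (at q)"
proof -
  define i where "i p = inverse (1 + inner p p)" for p :: 'a
  have "((\<lambda>p::'a. 1 + inner p p) has_derivative (\<lambda>v. 2 * inner q v)) (at q)"
    by (auto intro!: derivative_eq_intros simp: inner_commute)
  then have "(i has_derivative (\<lambda>v. - (r * (2 * inner q v) * r))) (at q)"
    unfolding i_def r_def
    by (rule Deriv.has_derivative_inverse[rotated]) (use one_plus_inner_pos[of q] in simp)
  then have i: "(i has_derivative (\<lambda>v. - 2 * inner q v * r\<^sup>2)) (at q)"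
    by (simp add: power2_eq_square mult_ac)
  \<comment> \<open>Since \<open>(s - 1) / (1 + s) = 1 - 2 / (1 + s)\<close>, both components depend
    on the squared norm only through \<open>i\<close>, and one derivative serves for both.\<close>
  have "param p = ((2 * i p) *\<^sub>R E p, e * (1 - 2 * i p))" for p
    using one_plus_inner_pos[of p] by (simp add: param_def i_def field_simps)
  then have param: "param = (\<lambda>p. ((2 * i p) *\<^sub>R E p, e * (1 - 2 * i p)))" ..
  have E: "(E has_derivative E) (at q)"
    by (rule bounded_linear_imp_has_derivative[OF bounded_linear_E])
  have "i q = r" by (simp add: i_def r_def)
  show ?thesis
    unfolding param
    by (rule has_derivative_eq_rhs, (rule derivative_intros i E)+)
      (simp add: fun_eq_iff \<open>i q = r\<close>)
qed

text \<open>Expanding the inner product leaves a multiple of \<open>inner v w\<close> and a multiple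
  of \<open>inner q v * inner q w\<close>. The latter has coefficient
  \<open>16 * (r^4 * (1 + s) - r^3)\<close>, which vanishes because
  \<open>r * (1 + s) = 1\<close>.\<close>

lemma conformal_param:
  "inner (frechet_derivative param (at q) v) (frechet_derivative param (at q) w)
    = 4 * (inverse (1 + inner q q))\<^sup>2 * inner v w"
proof -
  define s r where "s = inner q q" and "r = inverse (1 + s)"
  have "r * (1 + s) = 1" using one_plus_inner_pos[of q] by (simp add: s_def r_def)
  then have cancel: "r ^ 2 * r ^ 2 * (1 + s) = r ^ 2 * r" by algebra
  have e: "(e * a) * (e * b) = a * b" for a b using e_e by algebra
  have "inner (frechet_derivative param (at q) v) (frechet_derivative param (at q) w)
    = 4 * r ^ 2 * inner v w + 16 * (r ^ 2 * r ^ 2 * (1 + s) - r ^ 2 * r) * (inner q v * inner q w)"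
    unfolding frechet_derivative_at[OF has_derivative_param, symmetric]
      s_def[symmetric] r_def[symmetric] inner_Pair inner_real_def e
    by (simp add: inner_diff_left inner_diff_right inner_E inner_commute[of v q] inner_commute[of w q] flip: s_def)
       (simp add: algebra_simps power2_eq_square power4_eq_xxxx)
  then show ?thesis unfolding cancel by (simp add: s_def r_def)
qed

lemma conformal_diffeomorphism_param:
  "conformal_diffeomorphism UNIV (sphere 0 1 - {(0, e)}) param"
  unfolding conformal_diffeomorphism_def
proof (intro conjI ballI)
  show "smooth_on UNIV param"
    by (rule smooth_onI[OF open_UNIV _ Ck_on_param]) auto
  show "\<exists>c>0. \<forall>v w. inner (frechet_derivative param (at q) v) (frechet_derivative param (at q) w)
      = c * inner v w" for q
    using one_plus_inner_pos[of q]
    by (intro exI[of _ "4 * (inverse (1 + inner q q))\<^sup>2"]) (simp add: conformal_param)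
qed (simp_all add: bij_betw_param smooth_on_inv_param del: Diff_iff)

lemma homeomorphic_map_param:
  "homeomorphic_map euclidean (top_of_set (sphere 0 1 - {(0, e)})) param"
  unfolding homeomorphic_map_maps
proof (intro exI[of _ proj])
  have "continuous_on UNIV param" using Ck_on_param[of 0] by simp
  moreover have "continuous_on (sphere 0 1 - {(0, e)}) proj"
    by (rule continuous_on_subset[of "{z. 1 - e * snd z \<noteq> 0}"])
      (use Ck_on_proj[of 0] denominator_nonzero in \<open>simp_all only: Ck_on.simps subset_iff mem_Collect_eq, blast\<close>)
  ultimately show "homeomorphic_maps euclidean (top_of_set (sphere 0 1 - {(0, e)})) param proj"
    using param_in_sphere param_proj unfolding homeomorphic_maps_def
    by (simp add: proj_param continuous_map_in_subtopology image_subset_iff del: Diff_iff)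
qed

end

text \<open>Projecting from the other pole changes the denominator to
  \<open>1 + e * t = 2 * s / (1 + s)\<close>, so the scalar factors no longer cancel but leave
  \<open>1 / s\<close>. This computes both transition maps.\<close>

lemma proj_param_opposite:
  assumes "stereographic E e" "stereographic E' (- e)"
  shows "stereographic.proj E' (- e) (stereographic.param E e q) = (1 / inner q q) *\<^sub>R E' (E q)"
proof -
  interpret S: stereographic E e by fact
  interpret S': stereographic E' "- e" by fact
  define s where "s = inner q q"
  have s: "1 + s \<noteq> 0" using one_plus_inner_pos[of q] by (simp add: s_def)
  have "1 + e * (e * ((s - 1) / (1 + s))) = 2 * s / (1 + s)"
    using s S.e_e by (simp add: mult.assoc[symmetric] field_simps)
  \<comment> \<open>At \<open>s = 0\<close> both sides are 0 by the convention on division by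
    zero.\<close>
  moreover have "(1 + s) / (2 * s) * (2 / (1 + s)) = 1 / s"
    using s by (simp add: divide_simps)
  ultimately show ?thesis
    unfolding S.param_def S'.proj_def fst_conv snd_conv S'.E_scaleR scaleR_scaleR s_def[symmetric]
    by simp
qed


section \<open>Quaternions and octonions as real algebras\<close>

text \<open>By \<open>square_eq_minus_one_iff\<close> the imaginary units form the unit sphere of the orthogonal
  complement of \<open>1\<close>.\<close>

class slice_algebra = euclidean_space + one + times +
  assumes mult_right_distrib: "a * (b + c) = a * b + a * c"
    and scaleR_mult_right: "a * (r *\<^sub>R b) = r *\<^sub>R (a * b)"
    and mult_one_right: "a * 1 = a"
    and inner_one_one: "inner 1 1 = 1"
    and square_eq_minus_one_iff: "a * a = - 1 \<longleftrightarrow> inner 1 a = 0 \<and> inner a a = 1"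
    and dim_ge_2: "2 \<le> card Basis"

lemma square_neq_minus_one: "x * x \<noteq> - (1::real)"
  using zero_le_square[of x] by linarith

instance quat :: slice_algebra
proof
  fix a b c :: quat and r :: real
  show "a * (b + c) = a * b + a * c" "a * (r *\<^sub>R b) = r *\<^sub>R (a * b)" "a * 1 = a"
    by (simp_all add: quat_eq_iff times_quat_def plus_quat_def scaleR_quat_def one_quat_def
        algebra_simps)
  show "inner (1::quat) 1 = 1" by (simp add: inner_quat_def one_quat_def)
  show "2 \<le> card (Basis :: quat set)" by (simp add: DIM_quat)
  have "a * a = - 1 \<longleftrightarrow> qre a * qre a - qi a * qi a - qj a * qj a - qk a * qk a = - 1 \<and>
      qre a * qi a = 0 \<and> qre a * qj a = 0 \<and> qre a * qk a = 0"
    by (simp add: quat_eq_iff times_quat_def one_quat_def uminus_quat_def algebra_simps)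
  \<comment> \<open>A nonzero real part would make the imaginary part vanish, leaving a real number
    whose square is -1.\<close>
  also have "\<dots> \<longleftrightarrow> qre a = 0 \<and> qi a * qi a + qj a * qj a + qk a * qk a = 1"
    using square_neq_minus_one[of "qre a"] by (cases "qre a = 0") (simp, argo, auto)
  finally show "a * a = - 1 \<longleftrightarrow> inner 1 a = 0 \<and> inner a a = 1"
    by (auto simp: inner_quat_def one_quat_def)
qed

lemma quat_uminus_sel:
  "qre (- q) = - qre q" "qi (- q) = - qi q" "qj (- q) = - qj q" "qk (- q) = - qk q"
  by (simp_all add: uminus_quat_def)

text \<open>In Cayley-Dickson form the square of \<open>(a, b)\<close> is \<open>a^2 - |b|^2\<close>
  paired with \<open>2 Re(a) b\<close>, because a quaternion plus its conjugate, and a quaternion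
  multiplied by its conjugate, are real.\<close>

lemma oct_square_components:
  "qre (ofst (a * a)) = qre (ofst a) * qre (ofst a) - qi (ofst a) * qi (ofst a)
    - qj (ofst a) * qj (ofst a) - qk (ofst a) * qk (ofst a) - inner (osnd a) (osnd a)"
  "qi (ofst (a * a)) = 2 * qre (ofst a) * qi (ofst a)"
  "qj (ofst (a * a)) = 2 * qre (ofst a) * qj (ofst a)"
  "qk (ofst (a * a)) = 2 * qre (ofst a) * qk (ofst a)"
  "osnd (a * a) = (2 * qre (ofst a)) *\<^sub>R osnd a"
  by (simp_all add: times_oct_def times_quat_def minus_quat_def plus_quat_def qcnj_def
      scaleR_quat_def inner_quat_def algebra_simps)

instance oct :: slice_algebra
proof
  fix a b c :: oct and r :: real
  show "a * (b + c) = a * b + a * c" "a * (r *\<^sub>R b) = r *\<^sub>R (a * b)" "a * 1 = a"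
    by (simp_all add: oct_eq_iff times_oct_def plus_oct_def scaleR_oct_def one_oct_def qcnj_def
        quat_eq_iff times_quat_def plus_quat_def minus_quat_def scaleR_quat_def one_quat_def
        zero_quat_def algebra_simps)
  show "inner (1::oct) 1 = 1"
    by (simp add: inner_oct_def one_oct_def inner_quat_def one_quat_def zero_quat_def)
  show "2 \<le> card (Basis :: oct set)" by (simp add: DIM_oct)
  let ?x = "ofst a"
  have "a * a = - 1 \<longleftrightarrow>
      qre ?x * qre ?x - qi ?x * qi ?x - qj ?x * qj ?x - qk ?x * qk ?x - inner (osnd a) (osnd a) = - 1 \<and>
      qre ?x * qi ?x = 0 \<and> qre ?x * qj ?x = 0 \<and> qre ?x * qk ?x = 0 \<and>
      (qre ?x = 0 \<or> osnd a = 0)"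
    by (simp add: oct_eq_iff[of "a * a"] quat_eq_iff[of "ofst (a * a)"] oct_square_components
        uminus_oct_def one_oct_def quat_uminus_sel one_quat_def)
  \<comment> \<open>As for quaternions, a nonzero real part would kill all other components and
    leave a real square equal to -1.\<close>
  also have "\<dots> \<longleftrightarrow> qre ?x = 0 \<and>
      qi ?x * qi ?x + qj ?x * qj ?x + qk ?x * qk ?x + inner (osnd a) (osnd a) = 1"
    using square_neq_minus_one[of "qre ?x"] by (cases "qre ?x = 0") (simp, argo, auto)
  finally show "a * a = - 1 \<longleftrightarrow> inner 1 a = 0 \<and> inner a a = 1"
    by (auto simp: inner_oct_def one_oct_def inner_quat_def[of "Quat 1 0 0 0"] inner_quat_def[of "ofst a"]
        one_quat_def)
qed


section \<open>Slice coordinates\<close>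

lemma imag_units_iff: "I \<in> imag_units \<longleftrightarrow> inner 1 I = 0 \<and> inner I I = 1"
  for I :: "'a::slice_algebra"
  by (simp add: imag_units_def square_eq_minus_one_iff)

lemma inner_slice_point:
  fixes I :: "'a::slice_algebra"
  assumes "I \<in> imag_units"
  shows "inner (slice_point I x y) (slice_point I x y) = x\<^sup>2 + y\<^sup>2"
    and "inner 1 (slice_point I x y) = x"
  using assms by (simp_all add: imag_units_iff slice_point_def inner_add_left inner_add_right
      inner_one_one inner_commute[of I 1] power2_eq_square)

lemma slice_point_eq_0_iff:
  fixes I :: "'a::slice_algebra"
  assumes "I \<in> imag_units"
  shows "slice_point I x y = 0 \<longleftrightarrow> x\<^sup>2 + y\<^sup>2 = 0"
  using inner_slice_point(1)[OF assms, of x y] by (metis inner_eq_zero_iff)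

lemma slice_point_exists:
  obtains I x y where "(I::'a::slice_algebra) \<in> imag_units" "q = slice_point I x y"
proof -
  define v where "v = q - inner 1 q *\<^sub>R 1"
  have v: "inner 1 v = 0" by (simp add: v_def inner_diff_right inner_one_one)
  \<comment> \<open>For real \<open>q\<close> the imaginary part gives no direction; as
    \<open>y = 0\<close> then, any nonzero vector orthogonal to 1 will do, and one exists in
    dimension at least 2.\<close>
  obtain u where u: "inner 1 u = 0" "u \<noteq> 0" "v = 0 \<or> u = v"
  proof (cases "v = 0")
    case True
    obtain u where "u \<noteq> 0" "orthogonal (1::'a) u"
      using orthogonal_to_vector_exists[of "1::'a"] dim_ge_2 by auto
    with True that show ?thesis by (auto simp: orthogonal_def)
  qed (use that v in auto)
  define I where "I = (1 / norm u) *\<^sub>R u"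
  have "I \<in> imag_units"
    using u by (simp add: I_def imag_units_iff dot_square_norm power2_eq_square)
  moreover have "q = slice_point I (inner 1 q) (norm v)"
    using u by (auto simp: slice_point_def I_def v_def)
  ultimately show ?thesis by (rule that)
qed

text \<open>Conjugation expressed as the orthogonal reflection in the real axis, which treats both
  algebras uniformly.\<close>

definition cnj :: "'a::slice_algebra \<Rightarrow> 'a" where
  "cnj q = (2 * inner 1 q) *\<^sub>R 1 - q"

lemma cnj_slice_point:
  fixes I :: "'a::slice_algebra"
  assumes "I \<in> imag_units"
  shows "cnj (slice_point I x y) = slice_point I x (- y)"
  using inner_slice_point(2)[OF assms]
  by (simp add: cnj_def slice_point_def algebra_simps scaleR_2 flip: scaleR_scaleR)

interpretation F: stereographic "\<lambda>q::'a::slice_algebra. q" 1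
  by standard (simp_all add: linear_iff)

interpretation H: stereographic "cnj :: 'a::slice_algebra \<Rightarrow> 'a" "- 1"
proof (rule stereographic.intro)
  show "linear (cnj :: 'a \<Rightarrow> 'a)"
    by (simp add: cnj_def linear_iff inner_add_right algebra_simps)
  show "cnj (cnj q) = q" for q :: 'a
    by (simp add: cnj_def inner_diff_right inner_one_one algebra_simps)
  show "inner (cnj p) (cnj q) = inner p q" for p q :: 'a
    by (simp add: cnj_def inner_diff_right inner_diff_left inner_one_one algebra_simps
        inner_commute[of p 1])
qed simp

text \<open>Slice points exhaust the space, and on each of them \<open>x^2 + y^2\<close> is the
  squared norm.\<close>

lemma is_sphere_param_f_eq:
  fixes f :: "'a::slice_algebra \<Rightarrow> 'a \<times> real"
  assumes "is_sphere_param_f f"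
  shows "f = F.param"
proof
  fix q :: 'a
  obtain I x y where "I \<in> imag_units" "q = slice_point I x y"
    by (rule slice_point_exists)
  with assms show "f q = F.param q"
    by (simp add: is_sphere_param_f_def F.param_def inner_slice_point add.assoc)
qed

lemma is_sphere_param_h_eq:
  fixes h :: "'a::slice_algebra \<Rightarrow> 'a \<times> real"
  assumes "is_sphere_param_h h"
  shows "h = H.param"
proof
  fix q :: 'a
  obtain I x y where "I \<in> imag_units" "q = slice_point I x y"
    by (rule slice_point_exists)
  with assms show "h q = H.param q"
    by (simp add: is_sphere_param_h_def H.param_def inner_slice_point cnj_slice_point add.assoc
        flip: minus_divide_left)
qed


section \<open>Slice regularity of the inversion\<close>

text \<open>The point 1 is real and lies in every slice plane, so it witnesses both the real point
  and the nonemptiness of every slice.\<close>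

lemma slice_domainI:
  fixes W :: "'a::slice_algebra set"
  assumes "open W" "connected W" "1 \<in> W"
    and "\<And>I. I \<in> imag_units \<Longrightarrow> connected (W \<inter> slice_plane I)"
  shows "slice_domain W"
proof -
  have "slice_point I 1 0 = 1" for I :: 'a
    by (simp add: slice_point_def)
  then have "1 \<in> slice_plane I" for I :: 'a
    unfolding slice_plane_def by (metis (mono_tags, lifting) mem_Collect_eq)
  then show ?thesis
    using assms unfolding slice_domain_def
    by (auto simp: Int_commute[of W] openin_open_Int intro!: exI[of _ 1])
qed

lemma slice_plane_eq_image: "slice_plane I = (\<lambda>(x, y). slice_point I x y) ` UNIV"
  by (auto simp: slice_plane_def)

lemma continuous_on_slice_point: "continuous_on S (\<lambda>(x, y). slice_point I x y)"
  unfolding slice_point_def case_prod_beta by (intro continuous_intros)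

lemma slice_domain_UNIV: "slice_domain (UNIV :: 'a::slice_algebra set)"
  by (rule slice_domainI)
    (auto simp: slice_plane_eq_image intro!: connected_continuous_image continuous_on_slice_point)

text \<open>Removing a point from a space of dimension at least 2 keeps it connected. This applies
  to the whole space and to the coordinate plane, whose punctured image is the slice.\<close>

lemma slice_domain_punctured: "slice_domain (- {0 :: 'a::slice_algebra})"
proof (rule slice_domainI)
  show "connected (- {0::'a})"
    by (rule connected_punctured_universe[OF dim_ge_2])
  show "1 \<in> - {0::'a}"
    using inner_one_one[where 'a='a] by auto
  fix I :: 'a assume I: "I \<in> imag_units"
  have "- {0} \<inter> slice_plane I = (\<lambda>(x, y). slice_point I x y) ` (- {0})"
    using slice_point_eq_0_iff[OF I]
    by (auto simp: slice_plane_eq_image zero_prod_def image_iff)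
  moreover have "connected (- {0 :: real \<times> real})"
    by (rule connected_punctured_universe) simp
  ultimately show "connected (- {0} \<inter> slice_plane I)"
    by (simp add: connected_continuous_image continuous_on_slice_point)
qed (simp add: open_Compl)

text \<open>The partial derivatives are 1 and \<open>I\<close>, and
  \<open>1 + I * I = 0\<close>.\<close>

lemma slice_regular_on_ident:
  fixes g :: "'a::slice_algebra \<Rightarrow> 'a"
  assumes "\<And>q. g q = q"
  shows "slice_regular_on UNIV g"
  unfolding slice_regular_on_def
proof (intro conjI slice_domain_UNIV ballI)
  fix I :: 'a assume I: "I \<in> imag_units"
  then have "I * I = - 1" by (simp add: imag_units_def)
  then show "\<exists>gx gy :: real \<times> real \<Rightarrow> 'a.
      continuous_on {(x, y). slice_point I x y \<in> UNIV} gx \<and>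
      continuous_on {(x, y). slice_point I x y \<in> UNIV} gy \<and>
      (\<forall>x y. slice_point I x y \<in> UNIV \<longrightarrow>
        ((\<lambda>s. g (slice_point I s y)) has_vector_derivative gx (x, y)) (at x) \<and>
        ((\<lambda>t. g (slice_point I x t)) has_vector_derivative gy (x, y)) (at y) \<and>
        (1 / 2) *\<^sub>R (gx (x, y) + I * gy (x, y)) = 0)"
    by (intro exI[of _ "\<lambda>_. 1"] exI[of _ "\<lambda>_. I"])
      (auto simp: slice_point_def assms intro!: derivative_eq_intros)
qed

lemma slice_point_has_vector_derivative:
  assumes "(a has_real_derivative a') (at s)" "(b has_real_derivative b') (at s)"
  shows "((\<lambda>s. slice_point I (a s) (b s)) has_vector_derivative slice_point I a' b') (at s)"
  unfolding slice_point_def using assms by (auto intro!: derivative_eq_intros)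

text \<open>On each slice the map is \<open>1 / z\<close> in real coordinates. Its value at 0 is
  left free because a transition map is unspecified there.\<close>

lemma slice_regular_on_inversion:
  fixes g :: "'a::slice_algebra \<Rightarrow> 'a"
  assumes g: "\<And>q. q \<noteq> 0 \<Longrightarrow> g q = (1 / inner q q) *\<^sub>R cnj q"
  shows "slice_regular_on (- {0}) g"
  unfolding slice_regular_on_def
proof (intro conjI slice_domain_punctured ballI)
  fix I :: 'a assume I: "I \<in> imag_units"
  let ?D = "{(x, y). slice_point I x y \<in> - {0}}"
  \<comment> \<open>Real and imaginary parts of \<open>- 1 / z^2\<close>, the complex derivative of
    \<open>1 / z\<close>. Thus \<open>gx\<close> is this derivative and \<open>gy\<close> is
    \<open>I\<close> times it.\<close>
  define u v :: "real \<Rightarrow> real \<Rightarrow> real" where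
    "u x y = (y\<^sup>2 - x\<^sup>2) / (x\<^sup>2 + y\<^sup>2)\<^sup>2" and "v x y = 2 * x * y / (x\<^sup>2 + y\<^sup>2)\<^sup>2" for x y
  define gx gy :: "real \<times> real \<Rightarrow> 'a" where
    "gx = (\<lambda>(x, y). slice_point I (u x y) (v x y))" and
    "gy = (\<lambda>(x, y). slice_point I (- v x y) (u x y))"
  have D: "slice_point I x y \<noteq> 0 \<longleftrightarrow> x\<^sup>2 + y\<^sup>2 \<noteq> 0" for x y
    using slice_point_eq_0_iff[OF I] by simp
  then have "?D = {p. (fst p)\<^sup>2 + (snd p)\<^sup>2 \<noteq> 0}" by auto
  then have cont: "continuous_on ?D gx" "continuous_on ?D gy"
    unfolding gx_def gy_def u_def v_def slice_point_def case_prod_beta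
    by (auto intro!: continuous_intros)
  have g_slice: "g (slice_point I x y) = slice_point I (x / (x\<^sup>2 + y\<^sup>2)) (- y / (x\<^sup>2 + y\<^sup>2))"
    if "slice_point I x y \<noteq> 0" for x y
    unfolding g[OF that] inner_slice_point[OF I] cnj_slice_point[OF I]
    by (simp add: slice_point_def scaleR_diff_right)
  have "((\<lambda>s. g (slice_point I s y)) has_vector_derivative gx (x, y)) (at x)"
    if "slice_point I x y \<noteq> 0" for x y
  \<comment> \<open>The formula for \<open>g\<close> is known only off 0, but this is an open
    condition on \<open>s\<close>, so the formula determines the derivative.\<close>
  proof (rule has_vector_derivative_transform_within_open)
    have n: "x\<^sup>2 + y\<^sup>2 \<noteq> 0" using that D by blast
    have "((\<lambda>s. s / (s\<^sup>2 + y\<^sup>2)) has_real_derivative u x y) (at x)"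
      by (rule derivative_eq_intros refl n)+
        (use n in \<open>simp add: u_def power2_eq_square algebra_simps\<close>)
    moreover have "((\<lambda>s. - y / (s\<^sup>2 + y\<^sup>2)) has_real_derivative v x y) (at x)"
      by (rule derivative_eq_intros refl n)+
        (use n in \<open>simp add: v_def power2_eq_square algebra_simps\<close>)
    ultimately show "((\<lambda>s. slice_point I (s / (s\<^sup>2 + y\<^sup>2)) (- y / (s\<^sup>2 + y\<^sup>2)))
        has_vector_derivative gx (x, y)) (at x)"
      unfolding gx_def prod.case by (rule slice_point_has_vector_derivative)
    show "open {s. slice_point I s y \<noteq> 0}"
      unfolding slice_point_def by (intro open_Collect_neq continuous_intros)
  qed (use that g_slice in auto)
  moreover have "((\<lambda>t. g (slice_point I x t)) has_vector_derivative gy (x, y)) (at y)"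
    if "slice_point I x y \<noteq> 0" for x y
  proof (rule has_vector_derivative_transform_within_open)
    have n: "x\<^sup>2 + y\<^sup>2 \<noteq> 0" using that D by blast
    have "((\<lambda>t. x / (x\<^sup>2 + t\<^sup>2)) has_real_derivative - v x y) (at y)"
      by (rule derivative_eq_intros refl n)+
        (use n in \<open>simp add: v_def power2_eq_square algebra_simps\<close>)
    moreover have "((\<lambda>t. - t / (x\<^sup>2 + t\<^sup>2)) has_real_derivative u x y) (at y)"
      by (rule derivative_eq_intros refl n)+
        (use n in \<open>simp add: u_def power2_eq_square diff_divide_distrib[symmetric] algebra_simps\<close>)
    ultimately show "((\<lambda>t. slice_point I (x / (x\<^sup>2 + t\<^sup>2)) (- t / (x\<^sup>2 + t\<^sup>2)))
        has_vector_derivative gy (x, y)) (at y)"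
      unfolding gy_def prod.case by (rule slice_point_has_vector_derivative)
    show "open {t. slice_point I x t \<noteq> 0}"
      unfolding slice_point_def by (intro open_Collect_neq continuous_intros)
  qed (use that g_slice in auto)
  \<comment> \<open>Distributing \<open>I\<close> over \<open>gy\<close> and using
    \<open>I * I = - 1\<close> gives \<open>I * gy p = - gx p\<close>.\<close>
  moreover have "(1 / 2) *\<^sub>R (gx p + I * gy p) = 0" for p
    unfolding gx_def gy_def slice_point_def case_prod_beta mult_right_distrib
      scaleR_mult_right mult_one_right
    using I by (simp add: imag_units_def)
  ultimately show "\<exists>gx gy :: real \<times> real \<Rightarrow> 'a.
      continuous_on ?D gx \<and> continuous_on ?D gy \<and>
      (\<forall>x y. slice_point I x y \<in> - {0} \<longrightarrow>
        ((\<lambda>s. g (slice_point I s y)) has_vector_derivative gx (x, y)) (at x) \<and>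
        ((\<lambda>t. g (slice_point I x t)) has_vector_derivative gy (x, y)) (at y) \<and>
        (1 / 2) *\<^sub>R (gx (x, y) + I * gy (x, y)) = 0)"
    using cont by (intro exI[of _ gx] exI[of _ gy] conjI allI impI) simp_all
qed


section \<open>The atlas of the sphere\<close>

text \<open>The map is the reciprocal of a quadratic form that vanishes only at 0, times a linear
  map.\<close>

lemma smooth_on_inversion:
  fixes g :: "'a::slice_algebra \<Rightarrow> 'a"
  assumes g: "\<And>q. q \<noteq> 0 \<Longrightarrow> g q = (1 / inner q q) *\<^sub>R cnj q"
  shows "smooth_on (- {0}) g"
proof (rule smooth_onI)
  show W: "open (- {0::'a})" by (simp add: open_Compl)
  have "Ck_on k (- {0}) (\<lambda>q::'a. inverse (inner q q))" for k
    by (intro Ck_on_inverse Ck_on_bilinear[OF bounded_bilinear_inner] Ck_on_ident W) simp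
  then show "Ck_on k (- {0}) (\<lambda>q::'a. inverse (inner q q) *\<^sub>R cnj q)" for k
    by (intro Ck_on_bilinear[OF bounded_bilinear_scaleR] Ck_on_linear[OF H.bounded_linear_E]
        Ck_on_ident W)
qed (simp_all add: g inverse_eq_divide)

lemma smooth_on_ident:
  assumes "\<And>q. g q = q"
  shows "smooth_on UNIV g"
  by (rule smooth_onI[OF open_UNIV _ Ck_on_ident[OF open_UNIV]]) (simp_all add: assms)

lemma second_countable_euclidean:
  "second_countable (euclidean :: 'a::second_countable_topology topology)"
proof -
  obtain B :: "'a set set" where "countable B" "topological_basis B"
    using ex_countable_basis by blast
  then show ?thesis
    unfolding second_countable_def open_openin[symmetric]
    by (metis topological_basisE topological_basis_open)
qed

lemma openin_subtopology_minus_point: "openin (top_of_set S) (S - {p :: 'a::t1_space})"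
  by (simp add: Diff_eq openin_open_Int open_Compl)

section \<open>Overlaps, transition maps and the manifold structure\<close>

context
  fixes f h :: "'a::slice_algebra \<Rightarrow> 'a \<times> real"
  defines "f \<equiv> F.param" and "h \<equiv> H.param"
begin

lemma range_f: "range f = sphere 0 1 - {(0, 1)}" and range_h: "range h = sphere 0 1 - {(0, - 1)}"
  by (simp_all only: f_def h_def F.range_param H.range_param)

text \<open>On the sphere \<open>h\<close> misses only the south pole, which \<open>f\<close>
  attains exactly at 0.\<close>

lemma f_in_range_h_iff: "f q \<in> range h \<longleftrightarrow> q \<noteq> 0"
  using F.param_in_sphere[of q] F.param_eq_opposite_pole_iff[of q]
  by (simp only: range_h f_def Diff_iff singleton_iff) blast

lemma h_in_range_f_iff: "h q \<in> range f \<longleftrightarrow> q \<noteq> 0"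
  using H.param_in_sphere[of q] H.param_eq_opposite_pole_iff[of q]
  by (simp only: range_f h_def Diff_iff singleton_iff minus_minus) blast

lemma trans_dom_eq:
  "trans_dom (UNIV, f) (UNIV, f) = UNIV" "trans_dom (UNIV, h) (UNIV, h) = UNIV"
  "trans_dom (UNIV, f) (UNIV, h) = - {0}" "trans_dom (UNIV, h) (UNIV, f) = - {0}"
  by (auto simp add: trans_dom_def f_in_range_h_iff h_in_range_f_iff)

lemma trans_map_same:
  "trans_map (UNIV, f) (UNIV, f) q = q" "trans_map (UNIV, h) (UNIV, h) q = q"
  using F.inv_param[OF F.param_in_sphere, of q] H.inv_param[OF H.param_in_sphere, of q]
  by (simp_all add: trans_map_def f_def h_def F.proj_param H.proj_param)

text \<open>Off 0 the value of \<open>f\<close> lies in the range of \<open>h\<close>, so inverting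
  \<open>h\<close> means projecting from the south pole and conjugating.\<close>

lemma trans_map_f_h:
  assumes "q \<noteq> 0"
  shows "trans_map (UNIV, f) (UNIV, h) q = (1 / inner q q) *\<^sub>R cnj q"
proof -
  have "f q \<in> sphere 0 1 - {(0, - 1)}"
    using assms f_in_range_h_iff range_h by blast
  then have "trans_map (UNIV, f) (UNIV, h) q = H.proj (F.param q)"
    unfolding trans_map_def h_def f_def by (simp only: o_apply fst_conv snd_conv H.inv_param)
  then show ?thesis
    using proj_param_opposite[OF F.stereographic_axioms H.stereographic_axioms] by simp
qed

lemma trans_map_h_f:
  assumes "q \<noteq> 0"
  shows "trans_map (UNIV, h) (UNIV, f) q = (1 / inner q q) *\<^sub>R cnj q"
proof -
  have "h q \<in> sphere 0 1 - {(0, 1)}"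
    using assms h_in_range_f_iff range_f by blast
  then have "trans_map (UNIV, h) (UNIV, f) q = F.proj (H.param q)"
    unfolding trans_map_def h_def f_def by (simp only: o_apply fst_conv snd_conv F.inv_param)
  then show ?thesis
    using proj_param_opposite[of "cnj :: 'a \<Rightarrow> 'a" "- 1" "\<lambda>q. q"]
      F.stereographic_axioms H.stereographic_axioms by simp
qed

lemma homeomorphic_map_chart:
  "homeomorphic_map (top_of_set UNIV) (subtopology (top_of_set (sphere 0 1)) (range f)) f"
  "homeomorphic_map (top_of_set UNIV) (subtopology (top_of_set (sphere 0 1)) (range h)) h"
proof -
  have *: "sphere 0 1 \<inter> (sphere 0 1 - {p}) = sphere 0 1 - {p}" for p :: "'a \<times> real"
    by blast
  show "homeomorphic_map (top_of_set UNIV) (subtopology (top_of_set (sphere 0 1)) (range f)) f"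
    unfolding range_f subtopology_subtopology * subtopology_UNIV
    unfolding f_def
    by (rule F.homeomorphic_map_param)
  show "homeomorphic_map (top_of_set UNIV) (subtopology (top_of_set (sphere 0 1)) (range h)) h"
    unfolding range_h subtopology_subtopology * subtopology_UNIV
    unfolding h_def
    by (rule H.homeomorphic_map_param)
qed

lemma differentiable_manifold_sphere:
  "differentiable_manifold (top_of_set (sphere 0 1)) {(UNIV, f), (UNIV, h)}"
  unfolding differentiable_manifold_def
proof (intro conjI)
  show "Hausdorff_space (top_of_set (sphere 0 (1::real)) :: ('a \<times> real) topology)"
    by (simp add: Hausdorff_space_subtopology)
  show "second_countable (top_of_set (sphere 0 (1::real)) :: ('a \<times> real) topology)"
    by (intro second_countable_subtopology second_countable_euclidean)
  show "\<forall>(U, \<phi>)\<in>{(UNIV, f), (UNIV, h)}. open U \<and> openin (top_of_set (sphere 0 1)) (\<phi> ` U) \<and>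
      homeomorphic_map (top_of_set U) (subtopology (top_of_set (sphere 0 1)) (\<phi> ` U)) \<phi>"
    using homeomorphic_map_chart by (simp add: range_f range_h openin_subtopology_minus_point)
  \<comment> \<open>Since the omitted poles differ, each chart covers the point that the other
    misses.\<close>
  have "(0, 1) \<noteq> (0 :: 'a, - 1 :: real)" by simp
  then show "(\<Union>(U, \<phi>)\<in>{(UNIV, f), (UNIV, h)}. \<phi> ` U) = topspace (top_of_set (sphere 0 1))"
    using range_f range_h by auto
  show "\<forall>a\<in>{(UNIV, f), (UNIV, h)}. \<forall>b\<in>{(UNIV, f), (UNIV, h)}.
      smooth_on (trans_dom a b) (trans_map a b)"
    by (simp add: trans_dom_eq smooth_on_ident trans_map_same smooth_on_inversion trans_map_f_h
        trans_map_h_f)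
qed

lemma slice_manifold_sphere:
  "slice_manifold (top_of_set (sphere 0 1)) {(UNIV, f), (UNIV, h)}"
  unfolding slice_manifold_def
  by (simp add: differentiable_manifold_sphere trans_dom_eq slice_regular_on_ident trans_map_same
      slice_regular_on_inversion trans_map_f_h trans_map_h_f)

end

text \<open>Stated over the class so that quaternions and octonions are both instances of one
  argument.\<close>

lemma slice_structure_sphere:
  fixes f h :: "'a::slice_algebra \<Rightarrow> 'a \<times> real"
  assumes "is_sphere_param_f f" "is_sphere_param_h h"
  shows "conformal_diffeomorphism UNIV (sphere 0 1 - {(0, 1)}) f \<and>
    conformal_diffeomorphism UNIV (sphere 0 1 - {(0, - 1)}) h \<and>
    slice_manifold (top_of_set (sphere 0 1)) {(UNIV, f), (UNIV, h)}"
  unfolding is_sphere_param_f_eq[OF assms(1)] is_sphere_param_h_eq[OF assms(2)]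
  using F.conformal_diffeomorphism_param H.conformal_diffeomorphism_param slice_manifold_sphere
  by blast

theorem theorem4p2:
  shows "(\<forall>f h :: quat \<Rightarrow> quat \<times> real. is_sphere_param_f f \<longrightarrow> is_sphere_param_h h \<longrightarrow>
      conformal_diffeomorphism UNIV (sphere 0 1 - {(0, 1)}) f \<and>
      conformal_diffeomorphism UNIV (sphere 0 1 - {(0, - 1)}) h \<and>
      slice_quaternionic_manifold (top_of_set (sphere 0 1)) {(UNIV, f), (UNIV, h)}) \<and>
    (\<forall>f h :: oct \<Rightarrow> oct \<times> real. is_sphere_param_f f \<longrightarrow> is_sphere_param_h h \<longrightarrow>
      conformal_diffeomorphism UNIV (sphere 0 1 - {(0, 1)}) f \<and>
      conformal_diffeomorphism UNIV (sphere 0 1 - {(0, - 1)}) h \<and>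
      slice_octonionic_manifold (top_of_set (sphere 0 1)) {(UNIV, f), (UNIV, h)})"
  by (intro conjI[of "All _"] allI impI slice_structure_sphere)

end
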